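(* Let $C\subseteq\mathbb{R}^n$ be a rational pointed $n$-dimensional cone. Then \[ \operatorname{CR^{\rm a}}(C)\le\left\lfloor\tfrac{3}{2}n\right\rfloor . \]
   Context: A cone $C\subseteq\mathbb{R}^n$ is rational if $C=\{\bm{x}\in\mathbb{R}^n:\bm{A}\bm{x}\ge\bm{0}\}$ for some integer matrix $\bm{A}$; it is pointed if $C\cap(-C)=\{\bm{0}\}$; its dimension is the maximal number of linearly independent vectors in $C$. The integer points $S=C\cap\mathbb{Z}^n$ form a semigroup (closed under addition, containing $\bm 0$) which has a unique inclusion-minimal finite generating set $H(C)$ (every element of $S$ is a non-negative integer combination of elements of $H(C)$), called the Hilbert basis of $C$. For $\bm{x}\in S$, its representation length is $\sigma(\bm{x})=\min\{l:\bm{x}=\lambda_1\bm{h}_1+\cdots+\lambda_l\bm{h}_l,\ \lambda_i\in\mathbb{Z}_{\ge0},\ \bm{h}_i\in H(C)\}$. The asymptotic integer Carathéodory rank $\operatorname{CR^{\rm a}}(C)$ is the smallest positive integer $k$ such that \[ \lim_{\delta\to\infty}\frac{|\{\bm{x}\in S:\sigma(\bm{x})\le k\}\cap[-\delta,\delta]^n|}{|S\cap[-\delta,\delta]^n|}=1 . \] *)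

theory Defs
  imports "HOL-Analysis.Analysis"
begin

definition rational_cone :: "(real ^ 'n) set \<Rightarrow> bool" where
  "rational_cone C \<longleftrightarrow>
     (\<exists>(m::nat) (A :: nat \<Rightarrow> int ^ 'n).
        C = {x. \<forall>i<m. (\<Sum>j\<in>UNIV. of_int (A i $ j) * x $ j) \<ge> 0})"

definition pointed_cone :: "(real ^ 'n) set \<Rightarrow> bool" where
  "pointed_cone C \<longleftrightarrow> C \<inter> uminus ` C = {0}"

definition integer_points :: "(real ^ 'n) set \<Rightarrow> (real ^ 'n) set" where
  "integer_points C = {x \<in> C. \<forall>i. x $ i \<in> \<int>}"

definition finite_generating_set :: "(real ^ 'n) set \<Rightarrow> (real ^ 'n) set \<Rightarrow> bool" where
  "finite_generating_set S H \<longleftrightarrow>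
     finite H \<and> H \<subseteq> S \<and> (\<forall>x\<in>S. \<exists>c :: real ^ 'n \<Rightarrow> nat. x = (\<Sum>h\<in>H. real (c h) *\<^sub>R h))"

text \<open>For a rational pointed cone the description below determines exactly one set;
  for other arguments the value is unspecified.\<close>

definition hilbert_basis :: "(real ^ 'n) set \<Rightarrow> (real ^ 'n) set" where
  "hilbert_basis C =
     (THE H. finite_generating_set (integer_points C) H \<and>
             (\<forall>H'. H' \<subset> H \<longrightarrow> \<not> finite_generating_set (integer_points C) H'))"

text \<open>The \<open>h i\<close> need not be distinct and the coefficients may vanish; neither
  affects the minimum.\<close>

definition rep_length :: "(real ^ 'n) set \<Rightarrow> real ^ 'n \<Rightarrow> nat" where
  "rep_length C x =
     (LEAST l. \<exists>(c :: nat \<Rightarrow> nat) (h :: nat \<Rightarrow> real ^ 'n).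
        (\<forall>i<l. h i \<in> hilbert_basis C) \<and> x = (\<Sum>i<l. real (c i) *\<^sub>R h i))"

definition cube :: "real \<Rightarrow> (real ^ 'n) set" where
  "cube \<delta> = {x. \<forall>i. x $ i \<in> {-\<delta>..\<delta>}}"

definition asymptotic_CR :: "(real ^ 'n) set \<Rightarrow> nat" where
  "asymptotic_CR C =
     (LEAST k. 0 < k \<and>
        ((\<lambda>\<delta>::real.
            real (card ({x \<in> integer_points C. rep_length C x \<le> k} \<inter> cube \<delta>)) /
            real (card (integer_points C \<inter> cube \<delta>))) \<longlongrightarrow> 1) at_top)"

end

theory Submission
  imports Defs
begin

text \<open>
  Write \<open>n = CARD('n)\<close>. Among the linearly independent sets \<open>B\<close> of Hilbert basis elements whose cone
  contains \<open>x\<close>, choose one maximising the coefficient sum of \<open>x\<close>. For all \<open>x\<close> outside finitely many slabs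
  around hyperplanes, \<open>B\<close> has \<open>n\<close> elements and all coefficients of \<open>x\<close> are large; by maximality (a simplex
  pivot) the linear \<open>f\<close> with \<open>f = 1\<close> on \<open>B\<close> satisfies \<open>f \<ge> 1\<close> on the whole Hilbert basis. So an integer point
  \<open>z\<close> of the cone is a sum of at most \<open>f z\<close> Hilbert basis elements.

  Let \<open>z\<close> be the fractional part of \<open>x\<close> with respect to \<open>B\<close>, and \<open>z'\<close> the vector whose coefficients are
  one minus those of \<open>z\<close>. As \<open>f z + f z' = n\<close>, one of them has \<open>f\<close>-value at most \<open>n / 2\<close>. If it is \<open>z\<close>, then
  \<open>x\<close> is a combination of \<open>B\<close> and at most \<open>n div 2\<close> further elements. If it is \<open>z'\<close>, then modulo the lattice
  spanned by \<open>B\<close> the vector \<open>x\<close> is congruent to \<open>- z'\<close>, and each summand \<open>- h\<close> of \<open>- z'\<close> to \<open>(N - 1) h\<close>,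
  where \<open>N h\<close> lies in that lattice; since the coefficients of \<open>x\<close> are large, the lattice vector
  needed to correct the difference has nonnegative coefficients. The slabs contain only \<open>O(\<delta>\<^sup>n\<^sup>-\<^sup>1)\<close> integer points of
  the cube of radius \<open>\<delta>\<close>, whereas the cone contains at least a constant times \<open>\<delta>\<^sup>n\<close>.
\<close>

section \<open>Dickson's lemma, in terms of monotone subsequences\<close>

lemma nat_incseq_subseq:
  fixes s :: "nat \<Rightarrow> nat"
  shows "\<exists>r. strict_mono r \<and> incseq (\<lambda>k. s (r k))"
proof -
  obtain r where r: "strict_mono r" "monoseq (\<lambda>k. s (r k))"
    using seq_monosub by blast
  show ?thesis
  proof (cases "incseq (\<lambda>k. s (r k))")
    case False
    then have dec: "decseq (\<lambda>k. s (r k))" using r(2) by (simp add: monoseq_iff)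
    \<comment> \<open>A decreasing sequence of natural numbers is constant from the first place
      where it attains its minimum \<open>v\<close>, and a constant tail is increasing.\<close>
    define v where "v = (LEAST v. v \<in> range (\<lambda>k. s (r k)))"
    have "v \<in> range (\<lambda>k. s (r k))" unfolding v_def by (rule LeastI) auto
    then obtain N where N: "s (r N) = v" by auto
    have "s (r k) = v" if "k \<ge> N" for k
      using decseqD[OF dec that] N Least_le[of "\<lambda>v. v \<in> range (\<lambda>k. s (r k))" "s (r k)"]
      unfolding v_def by fastforce
    then have "incseq (\<lambda>k. s (r (k + N)))" by (simp add: incseq_def)
    moreover have "strict_mono (\<lambda>k. r (k + N))" using r(1) by (simp add: strict_mono_def)
    ultimately show ?thesis by blast
  qed (use r in blast)
qed

text \<open>The coordinates are treated one after another: passing to a further subsequence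
  preserves the monotonicity already achieved.\<close>

lemma dickson_subseq:
  fixes f :: "nat \<Rightarrow> nat \<Rightarrow> nat"
  shows "\<exists>r. strict_mono r \<and> (\<forall>i<m. incseq (\<lambda>k. f (r k) i))"
proof (induction m)
  case 0
  show ?case using strict_mono_id by auto
next
  case (Suc m)
  then obtain r where r: "strict_mono r" "\<And>i. i < m \<Longrightarrow> incseq (\<lambda>k. f (r k) i)" by blast
  obtain q where q: "strict_mono q" "incseq (\<lambda>k. f (r (q k)) m)"
    using nat_incseq_subseq[of "\<lambda>k. f (r k) m"] by auto
  have "incseq (\<lambda>k. f (r (q k)) i)" if "i < m" for i
    using r(2)[OF that] q(1) unfolding incseq_def by (meson strict_mono_less_eq)
  then have "\<forall>i<Suc m. incseq (\<lambda>k. f ((r \<circ> q) k) i)"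
    using q(2) by (auto simp: less_Suc_eq)
  then show ?case using strict_mono_o[OF r(1) q(1)] by blast
qed

section \<open>The Hilbert basis as the set of irreducible points\<close>

definition int_vec :: "real ^ 'n \<Rightarrow> bool" where
  "int_vec x \<longleftrightarrow> (\<forall>i. x $ i \<in> \<int>)"

lemma int_vec_add: "int_vec x \<Longrightarrow> int_vec y \<Longrightarrow> int_vec (x + y)"
  and int_vec_diff: "int_vec x \<Longrightarrow> int_vec y \<Longrightarrow> int_vec (x - y)"
  and int_vec_scaleR: "c \<in> \<int> \<Longrightarrow> int_vec x \<Longrightarrow> int_vec (c *\<^sub>R x)"
  by (auto simp: int_vec_def)

lemma int_vec_sum: "(\<And>i. i \<in> I \<Longrightarrow> int_vec (f i)) \<Longrightarrow> int_vec (sum f I)"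
  by (auto simp: int_vec_def intro!: Ints_sum)

lemma int_vec_inner: "int_vec x \<Longrightarrow> int_vec y \<Longrightarrow> x \<bullet> y \<in> \<int>"
  by (auto simp: int_vec_def inner_vec_def intro!: Ints_sum)

text \<open>The atoms of the monoid. They turn out to be the Hilbert basis, which replaces the
  definite description by an explicit set.\<close>

definition irreducibles :: "'a::monoid_add set \<Rightarrow> 'a set" where
  "irreducibles S = {x \<in> S. x \<noteq> 0 \<and> (\<forall>y\<in>S. \<forall>z\<in>S. x = y + z \<longrightarrow> y = 0 \<or> z = 0)}"

text \<open>The matrix is stored as real row vectors, so that the constraints become inner
  products.\<close>

locale pointed_int_cone =
  fixes m :: nat and a :: "nat \<Rightarrow> real ^ 'n" and C :: "(real ^ 'n) set"
  assumes int_rows: "int_vec (a i)"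
    and cone_eq: "C = {x. \<forall>i<m. 0 \<le> a i \<bullet> x}"
    and pointed: "x \<in> C \<Longrightarrow> - x \<in> C \<Longrightarrow> x = 0"
begin

abbreviation "S \<equiv> integer_points C"

lemma mem_S: "x \<in> S \<longleftrightarrow> x \<in> C \<and> int_vec x"
  by (auto simp: integer_points_def int_vec_def)

lemma cone_0: "0 \<in> C"
  and cone_add: "x \<in> C \<Longrightarrow> y \<in> C \<Longrightarrow> x + y \<in> C"
  and cone_scaleR: "x \<in> C \<Longrightarrow> 0 \<le> c \<Longrightarrow> c *\<^sub>R x \<in> C"
  by (auto simp: cone_eq inner_add_right)

lemma cone_sum: "(\<And>i. i \<in> I \<Longrightarrow> f i \<in> C) \<Longrightarrow> sum f I \<in> C"
  by (induction I rule: infinite_finite_induct) (auto simp: cone_0 cone_add)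

lemma S_sum_nat:
  assumes "H \<subseteq> S" shows "(\<Sum>h\<in>H. real (c h) *\<^sub>R h) \<in> S"
  using assms by (auto simp: mem_S subset_iff intro!: cone_sum int_vec_sum cone_scaleR int_vec_scaleR)

text \<open>By pointedness this functional is positive on the cone away from 0, and it is integral
  on integer points. It serves as an induction measure and as the \<open>p\<close> of the simplex
  lemmas below.\<close>

definition height :: "real ^ 'n" where "height = (\<Sum>i<m. a i)"

lemma height_nonneg: "x \<in> C \<Longrightarrow> 0 \<le> height \<bullet> x"
  by (auto simp: height_def inner_sum_left cone_eq intro!: sum_nonneg)

text \<open>If a sum of nonnegative constraint values vanishes, all of them do; then
  \<open>- x\<close> lies in the cone as well, against pointedness.\<close>

lemma height_pos:
  assumes "x \<in> C" "x \<noteq> 0" shows "0 < height \<bullet> x"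
proof (rule ccontr)
  assume "\<not> 0 < height \<bullet> x"
  then have "(\<Sum>i<m. a i \<bullet> x) = 0"
    using height_nonneg[OF assms(1)] by (simp add: height_def inner_sum_left)
  then have "\<forall>i<m. a i \<bullet> x = 0"
    using assms(1) by (subst (asm) sum_nonneg_eq_0_iff) (auto simp: cone_eq)
  then have "- x \<in> C" by (auto simp: cone_eq)
  then show False using pointed assms by blast
qed

lemma int_height: "int_vec height"
  unfolding height_def by (intro int_vec_sum int_rows)

text \<open>In an infinite set, Dickson's lemma applied to the constraint values gives distinct
  \<open>?x\<close> and \<open>?y\<close> such that \<open>?y - ?x\<close> stays in the cone. Then
  \<open>?y\<close> is the sum of \<open>?x\<close> and \<open>?y - ?x\<close>, both nonzero, and
  hence reducible.\<close>

lemma finite_irreducibles: "finite (irreducibles S)"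
proof (rule ccontr)
  assume "infinite (irreducibles S)"
  then obtain f :: "nat \<Rightarrow> real ^ 'n" where f: "inj f" "range f \<subseteq> irreducibles S"
    using infinite_countable_subset by blast
  have fS: "f k \<in> S" "f k \<noteq> 0" for k using f(2) by (auto simp: irreducibles_def)
  have fC: "f k \<in> C" and fI: "int_vec (f k)" for k using fS mem_S by auto
  obtain r where r: "strict_mono r" "\<And>i. i < m \<Longrightarrow> incseq (\<lambda>k. nat \<lfloor>a i \<bullet> f (r k)\<rfloor>)"
    using dickson_subseq[of m "\<lambda>k i. nat \<lfloor>a i \<bullet> f k\<rfloor>"] by auto
  let ?x = "f (r 0)" and ?y = "f (r 1)"
  have ne: "?y - ?x \<noteq> 0"
    using f(1) r(1) by (metis injD right_minus_eq strict_mono_eq zero_neq_one)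
  have "a i \<bullet> ?x \<le> a i \<bullet> ?y" if i: "i < m" for i
  proof -
    \<comment> \<open>The constraint values are nonnegative integers, so rounding them to
      \<open>nat\<close> for Dickson's lemma lost nothing.\<close>
    have "a i \<bullet> f k \<in> \<int>" "0 \<le> a i \<bullet> f k" for k
      using fC[of k] fI[of k] i int_rows by (auto simp: cone_eq int_vec_inner)
    then have "a i \<bullet> f k = real (nat \<lfloor>a i \<bullet> f k\<rfloor>)" for k
      by (smt (verit) Ints_cases floor_of_int of_nat_nat of_int_of_nat_eq zero_le_floor)
    moreover have "nat \<lfloor>a i \<bullet> ?x\<rfloor> \<le> nat \<lfloor>a i \<bullet> ?y\<rfloor>"
      using incseqD[OF r(2)[OF i], of 0 1] by simp
    ultimately show ?thesis by (metis of_nat_le_iff)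
  qed
  then have "?y - ?x \<in> S"
    unfolding mem_S using fI by (auto simp: cone_eq inner_diff_right intro!: int_vec_diff)
  moreover have "?y = ?x + (?y - ?x)" by simp
  moreover have "?y \<in> irreducibles S" using f(2) by auto
  ultimately show False using ne fS unfolding irreducibles_def by blast
qed

text \<open>Induction on the height: the heights of nonzero points of \<open>S\<close> are positive
  integers, so both parts of a proper decomposition are strictly lower.\<close>

lemma irreducibles_generate: "finite_generating_set S (irreducibles S)"
proof -
  have "\<exists>c :: real ^ 'n \<Rightarrow> nat. x = (\<Sum>h\<in>irreducibles S. real (c h) *\<^sub>R h)" if "x \<in> S" for x
    using that
  proof (induction "nat \<lfloor>height \<bullet> x\<rfloor>" arbitrary: x rule: less_induct)
    case less
    consider "x = 0" | "x \<in> irreducibles S"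
      | y z where "y \<in> S" "z \<in> S" "x = y + z" "y \<noteq> 0" "z \<noteq> 0"
      using less.prems unfolding irreducibles_def by blast
    then show ?case
    proof cases
      case 1
      then show ?thesis by (intro exI[of _ "\<lambda>_. 0"]) simp
    next
      case 2
      have "(\<Sum>h\<in>irreducibles S. real (of_bool (h = x)) *\<^sub>R h) = (\<Sum>h\<in>{x}. h)"
        using 2 finite_irreducibles by (intro sum.mono_neutral_cong_right) auto
      then show ?thesis by (intro exI[of _ "\<lambda>h. of_bool (h = x)"]) simp
    next
      case 3
      have pos: "0 < height \<bullet> u" "height \<bullet> u \<in> \<int>" if "u \<in> S" "u \<noteq> 0" for u
        using that by (auto simp: mem_S height_pos intro: int_vec_inner int_height)
      obtain p q :: int where pq: "height \<bullet> y = p" "height \<bullet> z = q"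
        using pos(2)[OF 3(1,4)] pos(2)[OF 3(2,5)] by (metis Ints_cases)
      have "p > 0" "q > 0" using pos(1)[OF 3(1,4)] pos(1)[OF 3(2,5)] pq by auto
      moreover have "height \<bullet> x = real_of_int (p + q)" using 3(3) pq by (simp add: inner_add_right)
      ultimately have "nat \<lfloor>height \<bullet> y\<rfloor> < nat \<lfloor>height \<bullet> x\<rfloor>" "nat \<lfloor>height \<bullet> z\<rfloor> < nat \<lfloor>height \<bullet> x\<rfloor>"
        using pq by simp_all
      then obtain c d where
        "y = (\<Sum>h\<in>irreducibles S. real (c h) *\<^sub>R h)" "z = (\<Sum>h\<in>irreducibles S. real (d h) *\<^sub>R h)"
        using less.hyps 3(1,2) by meson
      then show ?thesis using 3(3)
        by (intro exI[of _ "\<lambda>h. c h + d h"]) (simp add: sum.distrib scaleR_left_distrib)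
    qed
  qed
  then show ?thesis
    using finite_irreducibles by (auto simp: finite_generating_set_def irreducibles_def)
qed

text \<open>Split one copy of some nonzero \<open>h\<close> off a representation of
  \<open>x\<close>. The rest still lies in \<open>S\<close>, so irreducibility leaves only
  \<open>x = h\<close>.\<close>

lemma irreducibles_subset_generating:
  assumes "finite_generating_set S H" shows "irreducibles S \<subseteq> H"
proof
  fix x assume x: "x \<in> irreducibles S"
  then have xS: "x \<in> S" "x \<noteq> 0" by (auto simp: irreducibles_def)
  have H: "finite H" "H \<subseteq> S" using assms by (auto simp: finite_generating_set_def)
  obtain c :: "real ^ 'n \<Rightarrow> nat" where c: "x = (\<Sum>h\<in>H. real (c h) *\<^sub>R h)"
    using assms xS unfolding finite_generating_set_def by blast
  obtain h where h: "h \<in> H" "real (c h) *\<^sub>R h \<noteq> 0"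
    using xS(2) unfolding c by (meson sum.neutral)
  define d where "d = c(h := c h - 1)"
  have "x = real (c h) *\<^sub>R h + (\<Sum>g\<in>H-{h}. real (c g) *\<^sub>R g)"
    using c H(1) h(1) by (simp add: sum.remove)
  also have "(\<Sum>g\<in>H-{h}. real (c g) *\<^sub>R g) = (\<Sum>g\<in>H-{h}. real (d g) *\<^sub>R g)"
    by (intro sum.cong) (auto simp: d_def)
  also have "real (c h) *\<^sub>R h = h + real (d h) *\<^sub>R h"
    using h(2) by (auto simp: d_def of_nat_diff scaleR_left_diff_distrib)
  finally have "x = h + (\<Sum>g\<in>H. real (d g) *\<^sub>R g)"
    using H(1) h(1) by (simp add: sum.remove)
  moreover have "(\<Sum>g\<in>H. real (d g) *\<^sub>R g) \<in> S" by (rule S_sum_nat[OF H(2)])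
  moreover have "h \<in> S" "h \<noteq> 0" using H h by auto
  ultimately have "x = h" using x unfolding irreducibles_def by fastforce
  then show "x \<in> H" using h by simp
qed

text \<open>A generating set contained in every other finite generating set is the only minimal
  one.\<close>

lemma hilbert_basis_eq: "hilbert_basis C = irreducibles S"
  unfolding hilbert_basis_def
proof (rule the_equality)
  show "finite_generating_set S (irreducibles S) \<and>
      (\<forall>H'. H' \<subset> irreducibles S \<longrightarrow> \<not> finite_generating_set S H')"
    using irreducibles_generate irreducibles_subset_generating by blast
qed (use irreducibles_generate irreducibles_subset_generating in blast)

end

section \<open>Bases of maximal coefficient sum\<close>

text \<open>Caratheodory's theorem for cones, with control of the coefficient sum. While
  \<open>T\<close> is dependent, the coefficients move along a linear relation until one of them
  vanishes; the relation is oriented so that their sum does not drop.\<close>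

lemma cone_caratheodory_sum:
  fixes T :: "'a::real_inner set"
  assumes "finite T" "\<And>b. b \<in> T \<Longrightarrow> 0 < p \<bullet> b" "\<And>b. b \<in> T \<Longrightarrow> 0 \<le> u b"
  shows "\<exists>B v. B \<subseteq> T \<and> independent B \<and> (\<forall>b\<in>B. 0 \<le> v b) \<and>
           (\<Sum>b\<in>B. v b *\<^sub>R b) = (\<Sum>b\<in>T. u b *\<^sub>R b) \<and> sum u T \<le> sum v B"
  using assms
proof (induction T arbitrary: u rule: finite_psubset_induct)
  case (psubset T)
  show ?case
  proof (cases "independent T")
    case True
    then show ?thesis using psubset.prems by blast
  next
    case False
    then obtain w0 b1 where w0: "b1 \<in> T" "w0 b1 \<noteq> 0" "(\<Sum>b\<in>T. w0 b *\<^sub>R b) = 0"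
      using dependent_finite[OF psubset.hyps] by blast
    define w where "w b = (if 0 \<le> sum w0 T then w0 b else - w0 b)" for b
    have w: "w b1 \<noteq> 0" "(\<Sum>b\<in>T. w b *\<^sub>R b) = 0" "0 \<le> sum w T"
      using w0 by (cases "0 \<le> sum w0 T"; simp add: w_def sum_negf)+
    define N where "N = {b \<in> T. w b < 0}"
    \<comment> \<open>Some coefficient must decrease, so the movement stops: if \<open>w\<close>
      were nonnegative, applying \<open>p\<close> to the relation would force
      \<open>w b1 = 0\<close>.\<close>
    have "N \<noteq> {}"
    proof
      assume "N = {}"
      then have nn: "0 \<le> w b" if "b \<in> T" for b using that by (force simp: N_def)
      have "(\<Sum>b\<in>T. w b * (p \<bullet> b)) = p \<bullet> (\<Sum>b\<in>T. w b *\<^sub>R b)" by (simp add: inner_sum_right)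
      also have "\<dots> = 0" using w by simp
      finally have "\<forall>b\<in>T. w b * (p \<bullet> b) = 0"
        using nn psubset.prems(1) psubset.hyps by (subst (asm) sum_nonneg_eq_0_iff) (auto simp: less_imp_le)
      then show False using w(1) w0(1) psubset.prems(1) by force
    qed
    moreover have "finite N" using psubset.hyps by (simp add: N_def)
    ultimately obtain b0 where b0: "b0 \<in> N" "\<And>b. b \<in> N \<Longrightarrow> u b0 / - w b0 \<le> u b / - w b"
      using ex_is_arg_min_if_finite[of N "\<lambda>b. u b / - w b"] unfolding is_arg_min_linorder by blast
    \<comment> \<open>The ratio test: \<open>t\<close> is the longest step keeping all coefficients
      nonnegative, and it makes that of \<open>b0\<close> zero.\<close>
    define t where "t = u b0 / - w b0"
    have b0': "b0 \<in> T" "w b0 < 0" using b0 by (auto simp: N_def)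
    have t: "0 \<le> t" using b0' psubset.prems(2)[of b0] by (simp add: t_def divide_nonneg_neg)
    define u' where "u' b = u b + t * w b" for b
    have u'0: "u' b0 = 0" using b0' by (simp add: u'_def t_def)
    have u'nn: "0 \<le> u' b" if "b \<in> T" for b
    proof (cases "w b < 0")
      case True
      then have "t \<le> u b / - w b" using b0(2)[of b] that by (simp add: t_def N_def)
      then show ?thesis using True by (simp add: u'_def field_simps)
    next
      case False
      then show ?thesis using psubset.prems(2)[OF that] t by (simp add: u'_def)
    qed
    have "T - {b0} \<subset> T" using b0' by blast
    from psubset.IH[OF this, of u'] obtain B v where B: "B \<subseteq> T - {b0}" "independent B" "\<forall>b\<in>B. 0 \<le> v b"
      "(\<Sum>b\<in>B. v b *\<^sub>R b) = (\<Sum>b\<in>T - {b0}. u' b *\<^sub>R b)" "sum u' (T - {b0}) \<le> sum v B"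
      using u'nn psubset.prems(1) by auto
    have "(\<Sum>b\<in>T - {b0}. u' b *\<^sub>R b) = (\<Sum>b\<in>T. u' b *\<^sub>R b)"
      using u'0 b0' psubset.hyps by (simp add: sum.remove)
    also have "\<dots> = (\<Sum>b\<in>T. u b *\<^sub>R b) + t *\<^sub>R (\<Sum>b\<in>T. w b *\<^sub>R b)"
      by (simp add: u'_def scaleR_left_distrib sum.distrib scaleR_sum_right)
    finally have 1: "(\<Sum>b\<in>T - {b0}. u' b *\<^sub>R b) = (\<Sum>b\<in>T. u b *\<^sub>R b)" using w by simp
    have "sum u' (T - {b0}) = sum u' T"
      using u'0 b0' psubset.hyps by (simp add: sum.remove)
    also have "\<dots> = sum u T + t * sum w T"
      by (simp add: u'_def sum.distrib sum_distrib_left)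
    finally have "sum u T \<le> sum u' (T - {b0})" using w(3) t by simp
    then show ?thesis using B 1 by (intro exI[of _ B] exI[of _ v]) auto
  qed
qed

lemma independent_coeff_unique:
  assumes "independent B" "finite B" "(\<Sum>b\<in>B. u b *\<^sub>R b) = (\<Sum>b\<in>B. v b *\<^sub>R b)" "b \<in> B"
  shows "u b = v b"
proof -
  have "(\<Sum>b\<in>B. (u b - v b) *\<^sub>R b) = 0"
    using assms(3) by (simp add: scaleR_left_diff_distrib sum_subtractf)
  then show ?thesis using independentD[OF assms(1,2) order_refl _ assms(4)] by fastforce
qed

text \<open>\<open>B\<close> maximises the coefficient sum over the finitely many candidates. The
  last conclusion is the optimality criterion of the simplex method: if \<open>f h < 1\<close>,
  letting \<open>h\<close> enter would increase the sum. Positive coefficients leave room for this,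
  and \<open>span B\<close> is where \<open>f\<close> is determined by \<open>B\<close>.\<close>

lemma optimal_basis:
  fixes H :: "'a::real_inner set"
  assumes H: "finite H" "\<And>h. h \<in> H \<Longrightarrow> 0 < p \<bullet> h"
    and u: "\<And>h. h \<in> H \<Longrightarrow> 0 \<le> u h" "x = (\<Sum>h\<in>H. u h *\<^sub>R h)"
  obtains B v where "B \<subseteq> H" "independent B" "\<And>b. b \<in> B \<Longrightarrow> 0 \<le> v b" "x = (\<Sum>b\<in>B. v b *\<^sub>R b)"
    "\<forall>f. (\<forall>b\<in>B. 0 < v b) \<longrightarrow> linear f \<longrightarrow> (\<forall>b\<in>B. f b = (1::real)) \<longrightarrow> (\<forall>h\<in>H \<inter> span B. 1 \<le> f h)"
proof -
  define Q where "Q B v \<longleftrightarrow> B \<subseteq> H \<and> independent B \<and> (\<forall>b\<in>B. 0 \<le> v b) \<and> x = (\<Sum>b\<in>B. v b *\<^sub>R b)" for B v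
  define F where "F = {B. \<exists>v. Q B v}"
  have "finite F" by (rule finite_subset[of _ "Pow H"]) (auto simp: F_def Q_def H)
  moreover have "F \<noteq> {}"
    using cone_caratheodory_sum[OF H, of u] u unfolding F_def Q_def by fastforce
  \<comment> \<open>The choice is harmless, since coefficients over an independent set are
    unique.\<close>
  moreover define V where "V B = (SOME v. Q B v)" for B
  ultimately obtain B where B: "B \<in> F" "\<And>B'. B' \<in> F \<Longrightarrow> sum (V B') B' \<le> sum (V B) B"
    using ex_is_arg_min_if_finite[of F "\<lambda>B. - sum (V B) B"] by (auto simp: is_arg_min_linorder)
  have V: "Q B (V B)" if "B \<in> F" for B
    using that unfolding F_def V_def mem_Collect_eq by (rule someI_ex)
  have QB: "Q B (V B)" using B V by blast
  have finB: "finite B" using QB H(1) finite_subset unfolding Q_def by blast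
  have opt: "sum v B' \<le> sum (V B) B" if "Q B' v" for B' v
  proof -
    have B': "B' \<in> F" using that by (auto simp: F_def)
    have "sum v B' = sum (V B') B'"
    proof (rule sum.cong[OF refl])
      fix b assume "b \<in> B'"
      moreover have "finite B'" using that H(1) finite_subset unfolding Q_def by blast
      ultimately show "v b = V B' b"
        using that V[OF B'] independent_coeff_unique[of B' v "V B'"] by (auto simp: Q_def)
    qed
    then show ?thesis using B(2)[OF B'] by simp
  qed
  have "1 \<le> f h" if pos: "\<forall>b\<in>B. 0 < V B b" and f: "linear f" "\<forall>b\<in>B. f b = (1::real)"
      and h: "h \<in> H" "h \<in> span B" for f h
  proof (rule ccontr)
    assume less: "\<not> 1 \<le> f h"
    then have hB: "h \<notin> B" using f(2) by force
    obtain w where w: "h = (\<Sum>b\<in>B. w b *\<^sub>R b)"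
      using h(2) span_finite[OF finB] by auto
    have fh: "f h = sum w B" unfolding w by (simp add: linear_sum[OF f(1)] linear_scale[OF f(1)] f(2))
    obtain e where e: "0 < e" "\<And>b. b \<in> B \<Longrightarrow> e * w b \<le> V B b"
    proof (cases "B = {}")
      case True
      then show ?thesis using that[of 1] by simp
    next
      case False
      \<comment> \<open>The added 1 avoids a zero denominator; \<open>e\<close> is small enough to
        keep every coefficient nonnegative after the exchange.\<close>
      define e where "e = Min ((\<lambda>b. V B b / (\<bar>w b\<bar> + 1)) ` B)"
      have "0 < e" using False finB pos by (auto simp: e_def intro!: divide_pos_pos add_nonneg_pos)
      moreover have "e * w b \<le> V B b" if "b \<in> B" for b
      proof -
        have "e \<le> V B b / (\<bar>w b\<bar> + 1)" using finB that by (auto simp: e_def)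
        then have "e * (\<bar>w b\<bar> + 1) \<le> V B b" by (simp add: pos_le_divide_eq)
        moreover have "e * w b \<le> e * (\<bar>w b\<bar> + 1)" using \<open>0 < e\<close> by (intro mult_left_mono) auto
        ultimately show ?thesis by linarith
      qed
      ultimately show ?thesis using that by blast
    qed
    \<comment> \<open>Giving \<open>h\<close> the weight \<open>e\<close> changes the sum by
      \<open>e * (1 - f h) > 0\<close>. Reducing \<open>insert h B\<close> to an independent set
      keeps the gain and contradicts maximality.\<close>
    define v where "v b = (if b = h then e else V B b - e * w b)" for b
    have "(\<Sum>b\<in>insert h B. v b *\<^sub>R b) = e *\<^sub>R h + (\<Sum>b\<in>B. (V B b - e * w b) *\<^sub>R b)"
      using hB finB by (subst sum.insert) (auto simp: v_def intro!: sum.cong)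
    also have "\<dots> = e *\<^sub>R h + ((\<Sum>b\<in>B. V B b *\<^sub>R b) - e *\<^sub>R (\<Sum>b\<in>B. w b *\<^sub>R b))"
      by (simp add: scaleR_left_diff_distrib sum_subtractf scaleR_sum_right)
    also have "\<dots> = x" using QB w by (simp add: Q_def)
    finally have vx: "(\<Sum>b\<in>insert h B. v b *\<^sub>R b) = x" .
    have "sum v (insert h B) = e + (\<Sum>b\<in>B. V B b - e * w b)"
      using hB finB by (subst sum.insert) (auto simp: v_def intro!: sum.cong)
    also have "\<dots> = sum (V B) B + e * (1 - f h)"
      by (simp add: sum_subtractf sum_distrib_left[symmetric] fh algebra_simps)
    finally have vs: "sum (V B) B < sum v (insert h B)" using e(1) less by simp
    have sub: "insert h B \<subseteq> H" using QB h by (auto simp: Q_def)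
    have "0 < p \<bullet> b" if "b \<in> insert h B" for b using that sub H(2) by blast
    moreover have "0 \<le> v b" if "b \<in> insert h B" for b using that e by (auto simp: v_def less_imp_le)
    ultimately obtain B' v' where "B' \<subseteq> insert h B" "independent B'" "\<forall>b\<in>B'. 0 \<le> v' b"
        "(\<Sum>b\<in>B'. v' b *\<^sub>R b) = (\<Sum>b\<in>insert h B. v b *\<^sub>R b)" "sum v (insert h B) \<le> sum v' B'"
      using cone_caratheodory_sum[of "insert h B" p v] finB by blast
    then have "Q B' v'" "sum (V B) B < sum v' B'" using sub vx vs by (auto simp: Q_def)
    then show False using opt by fastforce
  qed
  then show thesis using that[of B "V B"] QB unfolding Q_def by blast
qed

section \<open>Integer vectors in boxes and slabs\<close>

lemma int_box:
  fixes lo hi :: "'n::finite \<Rightarrow> int"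
  defines "X \<equiv> {x :: real ^ 'n. int_vec x \<and> (\<forall>i. of_int (lo i) \<le> x $ i \<and> x $ i \<le> of_int (hi i))}"
  shows finite_int_box: "finite X" and card_int_box: "card X = (\<Prod>i\<in>UNIV. nat (hi i - lo i + 1))"
proof -
  let ?P = "\<Pi>\<^sub>E i\<in>UNIV. {lo i..hi i}" and ?g = "\<lambda>f. (\<chi> i. of_int (f i)) :: real ^ 'n"
  have X: "X = ?g ` ?P"
  proof (intro equalityI subsetI)
    fix x assume x: "x \<in> X"
    then have "x = ?g (\<lambda>i. \<lfloor>x $ i\<rfloor>)" by (auto simp: X_def int_vec_def vec_eq_iff)
    moreover have "(\<lambda>i. \<lfloor>x $ i\<rfloor>) \<in> ?P"
      using x by (auto simp: X_def le_floor_iff floor_le_iff) (smt (verit))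
    ultimately show "x \<in> ?g ` ?P" by (rule image_eqI)
  qed (auto simp: X_def int_vec_def PiE_iff)
  have "inj_on ?g ?P" by (auto simp: inj_on_def vec_eq_iff)
  then show "card X = (\<Prod>i\<in>UNIV. nat (hi i - lo i + 1))"
    unfolding X by (simp add: card_image card_PiE)
  show "finite X" unfolding X by (intro finite_imageI finite_PiE) auto
qed

lemma finite_int_vec_cube: "finite {x :: real ^ 'n. int_vec x \<and> (\<forall>i. \<bar>x $ i\<bar> \<le> r)}"
proof (rule finite_subset[OF _ finite_int_box])
  have "real_of_int (- \<lceil>r\<rceil>) \<le> t \<and> t \<le> real_of_int \<lceil>r\<rceil>" if "\<bar>t\<bar> \<le> r" for t
    using that le_of_int_ceiling[of r] unfolding of_int_minus by linarith
  then show "{x :: real ^ 'n. int_vec x \<and> (\<forall>i. \<bar>x $ i\<bar> \<le> r)} \<subseteq>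
    {x. int_vec x \<and> (\<forall>i. of_int (- \<lceil>r\<rceil>) \<le> x $ i \<and> x $ i \<le> of_int \<lceil>r\<rceil>)}"
    by blast
qed

lemma mem_cube: "x \<in> cube \<delta> \<longleftrightarrow> (\<forall>i. \<bar>x $ i\<bar> \<le> \<delta>)"
proof -
  have "t \<in> {- \<delta>..\<delta>} \<longleftrightarrow> \<bar>t\<bar> \<le> \<delta>" for t :: real by auto
  then show ?thesis by (simp add: cube_def)
qed

text \<open>Reduce the \<open>i\<close>-th coordinate modulo \<open>t\<close>, where
  \<open>a $ i\<close> is nonzero and \<open>t * \<bar>a $ i\<bar>\<close> exceeds the width of the
  slab. Points with the same image differ by a multiple of \<open>t\<close> in that coordinate
  alone, so within the slab they coincide. The image has \<open>t\<close> choices in coordinate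
  \<open>i\<close> and at most \<open>3 * \<delta>\<close> in each other one.\<close>

lemma card_slab_le:
  fixes a :: "real ^ 'n"
  assumes "a \<noteq> 0"
  shows "\<exists>c. \<forall>\<delta>\<ge>1. real (card ({x. int_vec x \<and> \<bar>a \<bullet> x\<bar> \<le> K} \<inter> cube \<delta>)) \<le> c * \<delta> ^ (CARD('n) - 1)"
proof -
  obtain i where i: "a $ i \<noteq> 0" using assms by (auto simp: vec_eq_iff)
  obtain t :: nat where "2 * \<bar>K\<bar> / \<bar>a $ i\<bar> < real t" using reals_Archimedean2 by blast
  then have t: "2 * \<bar>K\<bar> < real t * \<bar>a $ i\<bar>" using i by (simp add: field_simps)
  then have t0: "0 < t" by (cases t) auto
  show ?thesis
  proof (intro exI[of _ "real t * 3 ^ (CARD('n) - 1)"] allI impI)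
    fix \<delta> :: real assume \<delta>: "1 \<le> \<delta>"
    let ?X = "{x. int_vec x \<and> \<bar>a \<bullet> x\<bar> \<le> K} \<inter> cube \<delta> :: (real ^ 'n) set"
    let ?lo = "\<lambda>j. if j = i then 0 else - \<lfloor>\<delta>\<rfloor>" and ?hi = "\<lambda>j. if j = i then int t - 1 else \<lfloor>\<delta>\<rfloor>"
    let ?Y = "{x :: real ^ 'n. int_vec x \<and> (\<forall>j. of_int (?lo j) \<le> x $ j \<and> x $ j \<le> of_int (?hi j))}"
    let ?g = "\<lambda>x. (\<chi> j. if j = i then of_int (\<lfloor>x $ i\<rfloor> mod int t) else x $ j) :: real ^ 'n"
    have "inj_on ?g ?X"
    proof (rule inj_onI)
      fix x y assume x: "x \<in> ?X" and y: "y \<in> ?X" and eq: "?g x = ?g y"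
      have off: "x $ j = y $ j" if "j \<noteq> i" for j using arg_cong[OF eq, of "\<lambda>v. v $ j"] that by simp
      obtain p q where pq: "x $ i = of_int p" "y $ i = of_int q"
        using x y unfolding int_vec_def by (metis (no_types, lifting) Ints_cases Int_iff mem_Collect_eq)
      have "p mod int t = q mod int t" using arg_cong[OF eq, of "\<lambda>v. v $ i"] pq by simp
      then obtain s where s: "p - q = int t * s" by (metis mod_eq_dvd_iff dvdE)
      have "a \<bullet> (x - y) = (\<Sum>j\<in>{i}. a $ j * (x $ j - y $ j))"
        unfolding inner_vec_def using off by (intro sum.mono_neutral_cong_right) auto
      also have "\<dots> = a $ i * (real t * of_int s)" using pq s by (simp flip: of_int_diff)
      finally have "\<bar>a \<bullet> x - a \<bullet> y\<bar> = (real t * \<bar>a $ i\<bar>) * \<bar>of_int s\<bar>"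
        by (simp add: inner_diff_right abs_mult)
      moreover have "\<bar>a \<bullet> x - a \<bullet> y\<bar> \<le> 2 * \<bar>K\<bar>" using x y by auto
      ultimately have "(real t * \<bar>a $ i\<bar>) * \<bar>of_int s\<bar> < (real t * \<bar>a $ i\<bar>) * 1" using t by linarith
      then have "\<bar>of_int s :: real\<bar> < 1" using t0 i by (subst (asm) mult_less_cancel_left_pos) auto
      then have "s = 0" by linarith
      then show "x = y" using off pq s by (auto simp: vec_eq_iff) (metis)
    qed
    moreover have "?g ` ?X \<subseteq> ?Y"
    proof safe
      fix x :: "real ^ 'n" assume x: "int_vec x" "x \<in> cube \<delta>"
      show "int_vec (?g x)" using x by (auto simp: int_vec_def)
      fix j
      have xj: "- \<delta> \<le> x $ j" "x $ j \<le> \<delta>" using x by (auto simp: cube_def)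
      obtain p where p: "x $ j = of_int p" using x unfolding int_vec_def by (auto elim!: Ints_cases)
      have "p \<le> \<lfloor>\<delta>\<rfloor>" "- p \<le> \<lfloor>\<delta>\<rfloor>" using xj p by (simp_all add: le_floor_iff)
      then have pp: "- \<lfloor>\<delta>\<rfloor> \<le> p" "p \<le> \<lfloor>\<delta>\<rfloor>" by auto
      have "\<lfloor>x $ i\<rfloor> mod int t \<le> int t - 1" using t0 by (simp add: zle_diff1_eq)
      then have "real_of_int (\<lfloor>x $ i\<rfloor> mod int t) \<le> of_int (int t - 1)" by (simp only: of_int_le_iff)
      then show "?g x $ j \<le> of_int (?hi j)" using p pp by auto
      have "real_of_int (- \<lfloor>\<delta>\<rfloor>) \<le> of_int p" using pp by (simp only: of_int_le_iff)
      then show "of_int (?lo j) \<le> ?g x $ j" using p t0 by auto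
    qed
    ultimately have "card ?X \<le> card ?Y"
      by (rule card_inj_on_le) (rule finite_int_box)
    also have "\<dots> = (\<Prod>j\<in>UNIV. nat (?hi j - ?lo j + 1))" by (rule card_int_box)
    also have "\<dots> = t * (\<Prod>j\<in>UNIV - {i}. nat (2 * \<lfloor>\<delta>\<rfloor> + 1))"
      by (subst prod.remove[of _ i]) (auto intro!: prod.cong)
    also have "\<dots> = t * nat (2 * \<lfloor>\<delta>\<rfloor> + 1) ^ (CARD('n) - 1)" by (simp add: card_Diff_singleton)
    finally have "real (card ?X) \<le> real (t * nat (2 * \<lfloor>\<delta>\<rfloor> + 1) ^ (CARD('n) - 1))" by (simp only: of_nat_le_iff)
    also have "\<dots> = real t * real (nat (2 * \<lfloor>\<delta>\<rfloor> + 1)) ^ (CARD('n) - 1)" by simp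
    also have "\<dots> \<le> real t * (3 * \<delta>) ^ (CARD('n) - 1)"
    proof (intro mult_left_mono power_mono)
      have "0 \<le> \<lfloor>\<delta>\<rfloor>" using \<delta> by simp
      then have "real (nat (2 * \<lfloor>\<delta>\<rfloor> + 1)) = 2 * of_int \<lfloor>\<delta>\<rfloor> + 1" by simp
      then show "real (nat (2 * \<lfloor>\<delta>\<rfloor> + 1)) \<le> 3 * \<delta>" using \<delta> by linarith
    qed auto
    finally show "real (card ?X) \<le> real t * 3 ^ (CARD('n) - 1) * \<delta> ^ (CARD('n) - 1)"
      by (simp add: power_mult_distrib mult.assoc)
  qed
qed

section \<open>Short representations of deep points\<close>

text \<open>Pigeonhole: the multiples of \<open>z\<close>, reduced modulo the lattice of
  \<open>B\<close> to fractional coefficients, are integer vectors in a bounded region. Two of them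
  agree, and the difference of the two multiples is a lattice vector.\<close>

lemma int_multiple_in_lattice:
  fixes B :: "(real ^ 'n) set"
  assumes B: "finite B" "\<And>b. b \<in> B \<Longrightarrow> int_vec b" and z: "int_vec z" "z \<in> span B"
  shows "\<exists>N k. 0 < N \<and> real N *\<^sub>R z = (\<Sum>b\<in>B. of_int (k b) *\<^sub>R b)"
proof -
  obtain w where w: "z = (\<Sum>b\<in>B. w b *\<^sub>R b)" using z(2) span_finite[OF B(1)] by auto
  define g where "g j = (\<Sum>b\<in>B. frac (real j * w b) *\<^sub>R b)" for j :: nat
  have g: "real j *\<^sub>R z = g j + (\<Sum>b\<in>B. of_int \<lfloor>real j * w b\<rfloor> *\<^sub>R b)" for j
    unfolding g_def w
    by (simp add: sum.distrib[symmetric] scaleR_left_distrib[symmetric] frac_def scaleR_sum_right)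
  have "range g \<subseteq> {x. int_vec x \<and> (\<forall>i. \<bar>x $ i\<bar> \<le> (\<Sum>b\<in>B. norm b))}"
  proof safe
    fix j i
    have "g j = real j *\<^sub>R z - (\<Sum>b\<in>B. of_int \<lfloor>real j * w b\<rfloor> *\<^sub>R b)" using g[of j] by simp
    also have "int_vec \<dots>" by (intro int_vec_diff int_vec_scaleR int_vec_sum z(1) B(2)) auto
    finally show "int_vec (g j)" .
    have "\<bar>g j $ i\<bar> \<le> norm (g j)" by (rule component_le_norm_cart)
    also have "\<dots> \<le> (\<Sum>b\<in>B. norm b)" unfolding g_def
      by (rule sum_norm_le) (simp add: mult_left_le_one_le frac_lt_1 less_imp_le)
    finally show "\<bar>g j $ i\<bar> \<le> (\<Sum>b\<in>B. norm b)" .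
  qed
  then have "finite (range g)" using finite_int_vec_cube finite_subset by blast
  then have "\<not> inj g" using finite_imageD by blast
  then obtain i j where ij: "i < j" "g i = g j"
    unfolding inj_def by (metis linorder_neqE_nat)
  have "real (j - i) *\<^sub>R z = real j *\<^sub>R z - real i *\<^sub>R z"
    using ij by (simp add: of_nat_diff scaleR_left_diff_distrib)
  also have "\<dots> = (\<Sum>b\<in>B. of_int (\<lfloor>real j * w b\<rfloor> - \<lfloor>real i * w b\<rfloor>) *\<^sub>R b)"
    unfolding g using ij by (simp add: scaleR_left_diff_distrib sum_subtractf)
  finally show ?thesis using ij(1) by (intro exI[of _ "j - i"] exI[of _ "\<lambda>b. \<lfloor>real j * w b\<rfloor> - \<lfloor>real i * w b\<rfloor>"]) auto
qed

context pointed_int_cone begin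

abbreviation "H \<equiv> irreducibles S"

lemma H_S: "H \<subseteq> S" by (auto simp: irreducibles_def)

lemma H_pos: "h \<in> H \<Longrightarrow> 0 < height \<bullet> h"
  by (auto simp: irreducibles_def mem_S intro: height_pos)

text \<open>\<open>B\<close> and \<open>T\<close> may overlap; merging the coefficients on the union
  can only shorten the representation.\<close>

lemma rep_length_le:
  assumes T: "B \<subseteq> H" "T \<subseteq> H"
    and x: "x = (\<Sum>b\<in>B. real (p b) *\<^sub>R b) + (\<Sum>h\<in>T. real (c h) *\<^sub>R h)"
  shows "rep_length C x \<le> card B + card T"
proof -
  have fin: "finite B" "finite T" using T finite_irreducibles finite_subset by auto
  define d where "d h = (if h \<in> B then p h else 0) + (if h \<in> T then c h else 0)" for h
  have "(\<Sum>b\<in>B. real (p b) *\<^sub>R b) = (\<Sum>h\<in>B \<union> T. real (if h \<in> B then p h else 0) *\<^sub>R h)"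
    using fin by (intro sum.mono_neutral_cong_left) auto
  moreover have "(\<Sum>b\<in>T. real (c b) *\<^sub>R b) = (\<Sum>h\<in>B \<union> T. real (if h \<in> T then c h else 0) *\<^sub>R h)"
    using fin by (intro sum.mono_neutral_cong_left) auto
  ultimately have x': "x = (\<Sum>h\<in>B \<union> T. real (d h) *\<^sub>R h)"
    unfolding x d_def of_nat_add scaleR_left_distrib sum.distrib by simp
  obtain g where g: "bij_betw g {..<card (B \<union> T)} (B \<union> T)"
    using ex_bij_betw_nat_finite[of "B \<union> T"] fin by (auto simp: lessThan_atLeast0)
  have "(\<Sum>i<card (B \<union> T). real (d (g i)) *\<^sub>R g i) = x"
    unfolding x' using sum.reindex_bij_betw[OF g, of "\<lambda>h. real (d h) *\<^sub>R h"] by simp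
  moreover have "\<forall>i<card (B \<union> T). g i \<in> hilbert_basis C"
    using g T unfolding hilbert_basis_eq bij_betw_def by blast
  ultimately have "rep_length C x \<le> card (B \<union> T)"
    unfolding rep_length_def by (intro Least_le exI[of _ "\<lambda>i. d (g i)"] exI[of _ g]) auto
  then show ?thesis using card_Un_le[of B T] by linarith
qed

text \<open>As \<open>f\<close> is at least 1 on \<open>H\<close>, it bounds the coefficient sum and
  hence the number of elements used. The latter bound counts towards the length; the former limits
  the lattice correction for deep points.\<close>

lemma low_height_rep:
  assumes z: "z \<in> S" and f: "linear f" "\<And>h. h \<in> H \<Longrightarrow> (1::real) \<le> f h" and q: "f z < real q + 1"
  obtains c :: "real ^ 'n \<Rightarrow> nat" where "z = (\<Sum>h\<in>H. real (c h) *\<^sub>R h)" "sum c H \<le> q"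
    "card {h \<in> H. 0 < c h} \<le> q"
proof -
  obtain c :: "real ^ 'n \<Rightarrow> nat" where c: "z = (\<Sum>h\<in>H. real (c h) *\<^sub>R h)"
    using irreducibles_generate z unfolding finite_generating_set_def by blast
  have "real (sum c H) = (\<Sum>h\<in>H. real (c h) * 1)" by simp
  also have "\<dots> \<le> (\<Sum>h\<in>H. real (c h) * f h)" by (intro sum_mono mult_left_mono f(2)) auto
  also have "\<dots> = f z" unfolding c by (simp add: linear_sum[OF f(1)] linear_scale[OF f(1)])
  finally have "real (sum c H) < real q + 1" using q by linarith
  then have le: "sum c H \<le> q" by linarith
  have "card {h \<in> H. 0 < c h} = (\<Sum>h | h \<in> H \<and> 0 < c h. 1)" by simp
  also have "\<dots> \<le> (\<Sum>h | h \<in> H \<and> 0 < c h. c h)" by (intro sum_mono) auto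
  also have "\<dots> \<le> sum c H" using finite_irreducibles by (intro sum_mono2) auto
  finally show thesis using c le that by simp
qed

text \<open>The coefficients \<open>v\<close> are rounded down, with remainder \<open>z\<close>, or
  up, with excess \<open>z'\<close>, whichever has the smaller \<open>f\<close>-value.
  \<open>K\<close> depends on \<open>B\<close> only, so that one slab width serves all
  points.\<close>

lemma deep_rep_length_le:
  assumes B: "B \<subseteq> H" "independent B" "card B = CARD('n)"
  shows "\<exists>K\<ge>0. \<forall>x\<in>S. \<forall>v f. x = (\<Sum>b\<in>B. v b *\<^sub>R b) \<longrightarrow> (\<forall>b\<in>B. K \<le> v b) \<longrightarrow>
    linear f \<longrightarrow> (\<forall>b\<in>B. f b = 1) \<longrightarrow> (\<forall>h\<in>H. (1::real) \<le> f h) \<longrightarrow>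
    rep_length C x \<le> CARD('n) + CARD('n) div 2"
proof -
  have finB: "finite B" using B(1) finite_irreducibles finite_subset by blast
  have span: "span B = UNIV"
    using card_ge_dim_independent[of B UNIV] B by auto
  have BS: "int_vec b" "b \<in> C" if "b \<in> B" for b
    using that B(1) H_S mem_S by blast+
  have "\<exists>N k. 0 < N \<and> real N *\<^sub>R h = (\<Sum>b\<in>B. of_int (k b) *\<^sub>R b)" if "h \<in> H" for h
    using int_multiple_in_lattice[OF finB BS(1), of h] that H_S mem_S span by auto
  then obtain N k where Nk: "\<And>h. h \<in> H \<Longrightarrow> 0 < N h \<and> real (N h) *\<^sub>R h = (\<Sum>b\<in>B. of_int (k h b) *\<^sub>R b)"
    by metis
  \<comment> \<open>Rounding up will cost the coefficient of \<open>b\<close> the amount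
    \<open>c h * k h b\<close> for each \<open>h\<close>, where \<open>c h\<close> is at most the
    dimension; \<open>K\<close> dominates the total.\<close>
  define K where "K = real CARD('n) * (\<Sum>h\<in>H. \<Sum>b\<in>B. real_of_int \<bar>k h b\<bar>)"
  show ?thesis
  proof (intro exI[of _ K] conjI ballI allI impI)
    show K0: "0 \<le> K" by (simp add: K_def sum_nonneg)
    fix x v f
    assume x: "x \<in> S" "x = (\<Sum>b\<in>B. v b *\<^sub>R b)" and v: "\<forall>b\<in>B. K \<le> v b"
      and f: "linear f" "\<forall>b\<in>B. f b = (1::real)" "\<forall>h\<in>H. 1 \<le> f h"
    have f_sum: "f (\<Sum>b\<in>B. w b *\<^sub>R b) = sum w B" for w
      using f(2) by (simp add: linear_sum[OF f(1)] linear_scale[OF f(1)])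
    define z where "z = (\<Sum>b\<in>B. frac (v b) *\<^sub>R b)"
    define z' where "z' = (\<Sum>b\<in>B. (1 - frac (v b)) *\<^sub>R b)"
    have zx: "x = (\<Sum>b\<in>B. of_int \<lfloor>v b\<rfloor> *\<^sub>R b) + z"
      by (simp add: x(2) z_def sum.distrib[symmetric] scaleR_left_distrib[symmetric] frac_def)
    have zx': "x = (\<Sum>b\<in>B. of_int (\<lfloor>v b\<rfloor> + 1) *\<^sub>R b) - z'"
      by (simp add: x(2) z'_def sum_subtractf[symmetric] scaleR_left_diff_distrib[symmetric] frac_def)
    have intx: "int_vec x" using x(1) mem_S by auto
    have "z = x - (\<Sum>b\<in>B. of_int \<lfloor>v b\<rfloor> *\<^sub>R b)" using zx by simp
    moreover have "int_vec (x - (\<Sum>b\<in>B. of_int \<lfloor>v b\<rfloor> *\<^sub>R b))"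
      by (intro int_vec_diff intx int_vec_sum int_vec_scaleR BS) auto
    moreover have "z \<in> C" unfolding z_def by (intro cone_sum cone_scaleR BS) auto
    ultimately have zS: "z \<in> S" by (simp add: mem_S)
    have "z' = (\<Sum>b\<in>B. of_int (\<lfloor>v b\<rfloor> + 1) *\<^sub>R b) - x" using zx' by simp
    moreover have "int_vec ((\<Sum>b\<in>B. of_int (\<lfloor>v b\<rfloor> + 1) *\<^sub>R b) - x)"
      by (intro int_vec_diff intx int_vec_sum int_vec_scaleR BS) auto
    moreover have "z' \<in> C"
      unfolding z'_def by (intro cone_sum cone_scaleR BS) (auto simp: frac_lt_1 less_imp_le)
    ultimately have zS': "z' \<in> S" by (simp add: mem_S)
    have fz': "f z' = real CARD('n) - f z"
      unfolding z_def z'_def f_sum by (simp add: sum_subtractf B(3))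
    \<comment> \<open>Covers both parities of the dimension.\<close>
    have half: "real CARD('n) / 2 < real (CARD('n) div 2) + 1" by linarith
    show "rep_length C x \<le> CARD('n) + CARD('n) div 2"
    proof (cases "f z \<le> real CARD('n) / 2")
      case True
      then obtain c :: "real ^ 'n \<Rightarrow> nat" where c: "z = (\<Sum>h\<in>H. real (c h) *\<^sub>R h)"
        "card {h \<in> H. 0 < c h} \<le> CARD('n) div 2"
        using low_height_rep[OF zS f(1), of "CARD('n) div 2"] f(3) half by auto
      have "z = (\<Sum>h\<in>{h \<in> H. 0 < c h}. real (c h) *\<^sub>R h)"
        unfolding c(1) using finite_irreducibles by (intro sum.mono_neutral_right) auto
      moreover have "(\<Sum>b\<in>B. of_int \<lfloor>v b\<rfloor> *\<^sub>R b) = (\<Sum>b\<in>B. real (nat \<lfloor>v b\<rfloor>) *\<^sub>R b)"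
        using v K0 by (intro sum.cong) auto
      ultimately have "x = (\<Sum>b\<in>B. real (nat \<lfloor>v b\<rfloor>) *\<^sub>R b) + (\<Sum>h\<in>{h \<in> H. 0 < c h}. real (c h) *\<^sub>R h)"
        using zx by simp
      from rep_length_le[OF B(1) _ this] c(2) B(3) show ?thesis by auto
    next
      case False
      then have "f z' < real (CARD('n) div 2) + 1" using half fz' by linarith
      then obtain c :: "real ^ 'n \<Rightarrow> nat" where c: "z' = (\<Sum>h\<in>H. real (c h) *\<^sub>R h)"
        "sum c H \<le> CARD('n) div 2" "card {h \<in> H. 0 < c h} \<le> CARD('n) div 2"
        using low_height_rep[OF zS' f(1), of "CARD('n) div 2"] f(3) by auto
      \<comment> \<open>Each \<open>- h\<close> is rewritten as \<open>(N h - 1) h - N h h\<close>,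
        and the lattice vector \<open>N h h\<close> is expanded in \<open>B\<close>;
        \<open>p b\<close> collects what remains at \<open>b\<close>.\<close>
      define p where "p b = \<lfloor>v b\<rfloor> + 1 - (\<Sum>h\<in>H. int (c h) * k h b)" for b
      have p: "0 \<le> p b" if b: "b \<in> B" for b
      proof -
        have "real_of_int (\<Sum>h\<in>H. int (c h) * k h b) \<le> (\<Sum>h\<in>H. real CARD('n) * (\<Sum>b\<in>B. real_of_int \<bar>k h b\<bar>))"
          unfolding of_int_sum
        proof (rule sum_mono)
          fix h assume h: "h \<in> H"
          have "c h \<le> sum c H" using h finite_irreducibles by (simp add: member_le_sum)
          then have "real (c h) \<le> real CARD('n)" using c(2) by linarith
          moreover have "real_of_int \<bar>k h b\<bar> \<le> (\<Sum>b\<in>B. real_of_int \<bar>k h b\<bar>)"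
            using b finB by (intro member_le_sum) auto
          ultimately have "real (c h) * real_of_int \<bar>k h b\<bar> \<le> real CARD('n) * (\<Sum>b\<in>B. real_of_int \<bar>k h b\<bar>)"
            by (intro mult_mono) auto
          moreover have "real_of_int (int (c h) * k h b) \<le> real (c h) * real_of_int \<bar>k h b\<bar>"
            by (simp add: mult_left_mono)
          ultimately show "real_of_int (int (c h) * k h b) \<le> real CARD('n) * (\<Sum>b\<in>B. real_of_int \<bar>k h b\<bar>)"
            by linarith
        qed
        also have "\<dots> = K" by (simp add: K_def sum_distrib_left)
        also have "\<dots> \<le> v b" using v b by blast
        also have "\<dots> < real_of_int (\<lfloor>v b\<rfloor> + 1)" by linarith
        finally have "(\<Sum>h\<in>H. int (c h) * k h b) < \<lfloor>v b\<rfloor> + 1" by (simp only: of_int_less_iff)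
        then show ?thesis by (simp add: p_def)
      qed
      \<comment> \<open>Since \<open>N h\<close> is positive, the natural subtraction
        \<open>N h - 1\<close> is exact.\<close>
      have "(\<Sum>h\<in>H. real (c h) *\<^sub>R h) + (\<Sum>h\<in>H. real (c h * (N h - 1)) *\<^sub>R h)
          = (\<Sum>h\<in>H. real (c h) *\<^sub>R (real (N h) *\<^sub>R h))"
        unfolding sum.distrib[symmetric]
      proof (rule sum.cong[OF refl])
        fix h assume "h \<in> H"
        then have "real (c h * (N h - 1)) = real (c h) * real (N h) - real (c h)"
          using Nk[of h] by (simp add: of_nat_diff algebra_simps)
        then show "real (c h) *\<^sub>R h + real (c h * (N h - 1)) *\<^sub>R h = real (c h) *\<^sub>R real (N h) *\<^sub>R h"
          by (simp add: scaleR_left_diff_distrib)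
      qed
      also have "\<dots> = (\<Sum>h\<in>H. real (c h) *\<^sub>R (\<Sum>b\<in>B. of_int (k h b) *\<^sub>R b))"
        using Nk by (intro sum.cong) auto
      also have "\<dots> = (\<Sum>b\<in>B. \<Sum>h\<in>H. of_int (int (c h) * k h b) *\<^sub>R b)"
        by (simp add: scaleR_sum_right) (rule sum.swap)
      also have "\<dots> = (\<Sum>b\<in>B. of_int (\<Sum>h\<in>H. int (c h) * k h b) *\<^sub>R b)"
        by (simp only: of_int_sum scaleR_sum_left)
      finally have "x = (\<Sum>b\<in>B. of_int (\<lfloor>v b\<rfloor> + 1) *\<^sub>R b)
          - (\<Sum>b\<in>B. of_int (\<Sum>h\<in>H. int (c h) * k h b) *\<^sub>R b) + (\<Sum>h\<in>H. real (c h * (N h - 1)) *\<^sub>R h)"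
        unfolding zx' c(1) by (simp add: algebra_simps)
      also have "(\<Sum>b\<in>B. of_int (\<lfloor>v b\<rfloor> + 1) *\<^sub>R b) - (\<Sum>b\<in>B. of_int (\<Sum>h\<in>H. int (c h) * k h b) *\<^sub>R b)
          = (\<Sum>b\<in>B. of_int (p b) *\<^sub>R b)"
        unfolding p_def of_int_diff scaleR_left_diff_distrib sum_subtractf ..
      also have "\<dots> = (\<Sum>b\<in>B. real (nat (p b)) *\<^sub>R b)" using p by (intro sum.cong) auto
      \<comment> \<open>The new coefficients vanish wherever \<open>c\<close> does, so the rewriting
        uses no further elements of \<open>H\<close>.\<close>
      also have "(\<Sum>h\<in>H. real (c h * (N h - 1)) *\<^sub>R h) = (\<Sum>h\<in>{h \<in> H. 0 < c h}. real (c h * (N h - 1)) *\<^sub>R h)"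
        using finite_irreducibles by (intro sum.mono_neutral_right) auto
      finally show ?thesis using rep_length_le[OF B(1), of "{h \<in> H. 0 < c h}"] c(3) B(3) by fastforce
    qed
  qed
qed

text \<open>Each set of fewer than \<open>CARD('n)\<close> elements of \<open>H\<close> lies in a
  hyperplane, whose normal goes into \<open>F\<close>. A long point has an optimal \<open>B\<close>
  that is too small, so it lies on the hyperplane of \<open>B\<close>; or some coefficient
  \<open>v b\<close> is below \<open>K0\<close>, so it lies near that of \<open>B - {b}\<close>.
  Otherwise \<open>deep_rep_length_le\<close> would apply.\<close>

lemma long_in_slabs:
  obtains F :: "(real ^ 'n) set" and K :: real where "finite F" "0 \<notin> F"
    "\<And>x. x \<in> S \<Longrightarrow> CARD('n) + CARD('n) div 2 < rep_length C x \<Longrightarrow> \<exists>a\<in>F. \<bar>a \<bullet> x\<bar> \<le> K"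
proof -
  define FT where "FT = {T. T \<subseteq> H \<and> card T < CARD('n)}"
  define FB where "FB = {B. B \<subseteq> H \<and> independent B \<and> card B = CARD('n)}"
  have fin: "finite FT" "finite FB"
    by (rule finite_subset[of _ "Pow H"]; auto simp: FT_def FB_def finite_irreducibles)+
  have "\<exists>a::real^'n. a \<noteq> 0 \<and> (\<forall>t\<in>T. a \<bullet> t = 0)" if "T \<in> FT" for T
  proof -
    have "finite T" using that finite_irreducibles finite_subset by (auto simp: FT_def)
    then have "dim T < DIM(real^'n)"
      using dim_le_card[of T T] that by (auto simp: FT_def span_superset)
    from lowdim_subset_hyperplane[OF this] show ?thesis using span_superset[of T] by blast
  qed
  then obtain aT :: "(real^'n) set \<Rightarrow> real^'n" where aT: "\<And>T. T \<in> FT \<Longrightarrow> aT T \<noteq> 0"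
      "\<And>T t. T \<in> FT \<Longrightarrow> t \<in> T \<Longrightarrow> aT T \<bullet> t = 0"
    by metis
  define good where "good B K \<longleftrightarrow> K \<ge> 0 \<and> (\<forall>x\<in>S. \<forall>v f. x = (\<Sum>b\<in>B. v b *\<^sub>R b) \<longrightarrow> (\<forall>b\<in>B. K \<le> v b) \<longrightarrow>
    linear f \<longrightarrow> (\<forall>b\<in>B. f b = 1) \<longrightarrow> (\<forall>h\<in>H. (1::real) \<le> f h) \<longrightarrow>
    rep_length C x \<le> CARD('n) + CARD('n) div 2)" for B K
  have "\<forall>B\<in>FB. \<exists>K. good B K"
    unfolding good_def FB_def using deep_rep_length_le by auto
  then obtain KB where KB: "\<And>B. B \<in> FB \<Longrightarrow> good B (KB B)"
    using bchoice[of FB good] by blast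
  \<comment> \<open>The added 1 makes \<open>K0\<close> positive, so coefficients of at least
    \<open>K0\<close> meet the positivity condition in \<open>opt\<close>.\<close>
  define K0 where "K0 = sum KB FB + 1"
  have KB0: "0 \<le> KB B" if "B \<in> FB" for B using KB[OF that] by (simp add: good_def)
  have K0: "KB B \<le> K0" if "B \<in> FB" for B
    using member_le_sum[OF that, of KB] KB0 fin by (auto simp: K0_def)
  have K0pos: "0 < K0" unfolding K0_def using sum_nonneg[of FB KB] KB0 by force
  define M where "M = (\<Sum>T\<in>FT. \<Sum>h\<in>H. \<bar>aT T \<bullet> h\<bar>)"
  have M: "\<bar>aT T \<bullet> h\<bar> \<le> M" if "T \<in> FT" "h \<in> H" for T h
  proof -
    have "\<bar>aT T \<bullet> h\<bar> \<le> (\<Sum>h\<in>H. \<bar>aT T \<bullet> h\<bar>)"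
      using that finite_irreducibles by (intro member_le_sum) auto
    also have "\<dots> \<le> M"
      unfolding M_def using that fin by (intro member_le_sum) (auto intro: sum_nonneg)
    finally show ?thesis .
  qed
  have M0: "0 \<le> M" by (auto simp: M_def intro!: sum_nonneg)
  show thesis
  proof
    show "finite (aT ` FT)" "0 \<notin> aT ` FT" using fin aT by auto
    fix x assume x: "x \<in> S" and long: "CARD('n) + CARD('n) div 2 < rep_length C x"
    obtain c :: "real ^ 'n \<Rightarrow> nat" where c: "x = (\<Sum>h\<in>H. real (c h) *\<^sub>R h)"
      using irreducibles_generate x unfolding finite_generating_set_def by blast
    obtain B v where B: "B \<subseteq> H" "independent B" and v: "\<And>b. b \<in> B \<Longrightarrow> 0 \<le> v b" "x = (\<Sum>b\<in>B. v b *\<^sub>R b)"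
      and opt: "\<forall>f. (\<forall>b\<in>B. 0 < v b) \<longrightarrow> linear f \<longrightarrow> (\<forall>b\<in>B. f b = (1::real)) \<longrightarrow> (\<forall>h\<in>H \<inter> span B. 1 \<le> f h)"
      by (rule optimal_basis[OF finite_irreducibles H_pos _ c]) auto
    have finB: "finite B" using B(1) finite_irreducibles finite_subset by blast
    have "card B \<le> CARD('n)" using independent_bound[OF B(2)] by simp
    then consider "card B < CARD('n)" | "card B = CARD('n)" by linarith
    then show "\<exists>a\<in>aT ` FT. \<bar>a \<bullet> x\<bar> \<le> K0 * M"
    proof cases
      case 1
      then have BF: "B \<in> FT" using B by (simp add: FT_def)
      have "aT B \<bullet> x = 0" unfolding v(2) using aT(2)[OF BF] by (simp add: inner_sum_right)
      then show ?thesis using BF K0pos M0 by (intro bexI[of _ "aT B"]) auto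
    next
      case 2
      then have BF: "B \<in> FB" using B by (simp add: FB_def)
      have "\<exists>b\<in>B. v b < K0"
      proof (rule ccontr)
        assume "\<not> ?thesis"
        then have ge: "K0 \<le> v b" if "b \<in> B" for b using that by force
        obtain f :: "real^'n \<Rightarrow> real" where f: "linear f" "\<forall>b\<in>B. f b = 1"
          using linear_independent_extend[OF B(2), of "\<lambda>_. 1"] by blast
        have "span B = UNIV" using card_ge_dim_independent[of B UNIV] B 2 by auto
        then have "\<forall>h\<in>H. 1 \<le> f h" using opt f ge K0pos by force
        moreover have "\<forall>b\<in>B. KB B \<le> v b" using ge K0[OF BF] by force
        ultimately have "rep_length C x \<le> CARD('n) + CARD('n) div 2"
          using KB[OF BF, unfolded good_def, THEN conjunct2, rule_format, where v = v and f = f, OF x v(2)] f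
          by blast
        then show False using long by simp
      qed
      then obtain b where b: "b \<in> B" "v b < K0" by blast
      have TF: "B - {b} \<in> FT" using B(1) 2 b(1) finB by (auto simp: FT_def card_gt_0_iff)
      \<comment> \<open>Only \<open>b\<close> contributes: the rest of \<open>B\<close> lies in the
        hyperplane.\<close>
      have "aT (B - {b}) \<bullet> x = v b * (aT (B - {b}) \<bullet> b)"
        unfolding v(2) using aT(2)[OF TF] finB b(1)
        by (simp add: sum.remove inner_add_right inner_sum_right)
      then have "\<bar>aT (B - {b}) \<bullet> x\<bar> = v b * \<bar>aT (B - {b}) \<bullet> b\<bar>"
        using v(1)[OF b(1)] by (simp add: abs_mult)
      also have "\<dots> \<le> K0 * M" using b B M[OF TF, of b] K0pos by (intro mult_mono) auto
      finally show ?thesis using TF by blast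
    qed
  qed
qed

section \<open>Density\<close>

text \<open>The sum \<open>u\<close> of a basis inside the cone satisfies each nonzero constraint
  strictly, because only a zero row is orthogonal to a spanning set. A large multiple of
  \<open>u\<close> can then be rounded to an integer vector and perturbed by
  \<open>y\<close>.\<close>

lemma int_vec_deep_interior:
  assumes "dim C = CARD('n)"
  obtains v where "int_vec v" "\<And>y. (\<And>j. \<bar>y $ j\<bar> \<le> 1) \<Longrightarrow> v + y \<in> C"
proof -
  obtain B where B: "B \<subseteq> C" "independent B" "card B = CARD('n)"
    using basis_exists[of C] assms by metis
  have span: "span B = UNIV" using card_ge_dim_independent[of B UNIV] B by auto
  have finB: "finite B" using B(2) finiteI_independent by blast
  define u where "u = \<Sum>B"
  define s where "s i = (\<Sum>j\<in>UNIV. \<bar>a i $ j\<bar>)" for i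
  have s0: "0 \<le> s i" for i by (simp add: s_def sum_nonneg)
  have nn: "0 \<le> a i \<bullet> b" if "i < m" "b \<in> B" for i b using that B(1) cone_eq by blast
  have u: "a i = 0 \<or> 0 < a i \<bullet> u" if i: "i < m" for i
  proof (rule disjCI)
    assume "\<not> 0 < a i \<bullet> u"
    then have "(\<Sum>b\<in>B. a i \<bullet> b) = 0"
      using sum_nonneg[of B "\<lambda>b. a i \<bullet> b"] nn[OF i] by (auto simp: u_def inner_sum_right not_less intro: antisym)
    then have "\<forall>b\<in>B. a i \<bullet> b = 0" using nn[OF i] finB by (subst (asm) sum_nonneg_eq_0_iff) auto
    then have "orthogonal (a i) (a i)"
      using orthogonal_to_span[of "a i" B "a i"] span by (auto simp: orthogonal_def)
    then show "a i = 0" by (simp add: orthogonal_def)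
  qed
  \<comment> \<open>For a zero row the summand is \<open>0 / 0 = 0\<close>.\<close>
  define t where "t = (\<Sum>i<m. 2 * s i / (a i \<bullet> u))"
  have term0: "0 \<le> 2 * s i / (a i \<bullet> u)" if "i < m" for i
    using u[OF that] s0 by auto
  have t: "2 * s i \<le> t * (a i \<bullet> u)" if i: "i < m" for i
  proof (cases "a i = 0")
    case True
    then show ?thesis by (simp add: s_def)
  next
    case False
    then have "0 < a i \<bullet> u" using u i by blast
    moreover have "2 * s i / (a i \<bullet> u) \<le> t" unfolding t_def using i term0 by (intro member_le_sum) auto
    ultimately show ?thesis by (simp add: pos_divide_le_eq)
  qed
  define v :: "real ^ 'n" where "v = (\<chi> j. of_int \<lceil>t * u $ j\<rceil>)"
  have "v + y \<in> C" if y: "\<And>j. \<bar>y $ j\<bar> \<le> 1" for y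
  proof -
    define e where "e = v + y - t *\<^sub>R u"
    \<comment> \<open>One unit comes from rounding up and one from \<open>y\<close>.\<close>
    have e: "\<bar>e $ j\<bar> \<le> 2" for j using y[of j] unfolding e_def v_def by simp linarith
    have "0 \<le> a i \<bullet> (v + y)" if i: "i < m" for i
    proof -
      have "\<bar>a i \<bullet> e\<bar> \<le> (\<Sum>j\<in>UNIV. \<bar>a i $ j * e $ j\<bar>)"
        unfolding inner_vec_def by (simp add: sum_abs)
      also have "\<dots> \<le> (\<Sum>j\<in>UNIV. \<bar>a i $ j\<bar> * 2)"
        unfolding abs_mult by (intro sum_mono mult_left_mono e) auto
      finally have "\<bar>a i \<bullet> e\<bar> \<le> 2 * s i" by (simp add: s_def sum_distrib_left mult.commute)
      moreover have "a i \<bullet> (v + y) = t * (a i \<bullet> u) + a i \<bullet> e" by (simp add: e_def inner_diff_right)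
      ultimately show ?thesis using t[OF i] by linarith
    qed
    then show ?thesis by (simp add: cone_eq)
  qed
  moreover have "int_vec v" by (simp add: v_def int_vec_def)
  ultimately show thesis using that by blast
qed

lemma finite_S_cube: "finite (S \<inter> cube \<delta>)"
  by (rule finite_subset[OF _ finite_int_vec_cube[of \<delta>]]) (auto simp: mem_S mem_cube)

text \<open>Scaling the cube around \<open>v\<close> by \<open>r\<close> gives a cube of radius
  \<open>r\<close> around \<open>r v\<close> inside the cone. Its integer points are a translate of
  a box, and \<open>r * V \<le> \<delta>\<close> keeps them within
  \<open>cube \<delta>\<close>.\<close>

lemma card_S_cube_ge:
  assumes "dim C = CARD('n)"
  shows "\<exists>V>0. \<forall>\<delta>\<ge>0. (\<delta> / V) ^ CARD('n) \<le> real (card (S \<inter> cube \<delta>))"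
proof -
  obtain v where v: "int_vec v" "\<And>y. (\<And>j. \<bar>y $ j\<bar> \<le> 1) \<Longrightarrow> v + y \<in> C"
    using int_vec_deep_interior[OF assms] by blast
  define V where "V = norm v + 1"
  have V: "0 < V" by (simp add: V_def add_nonneg_pos)
  show ?thesis
  proof (intro exI[of _ V] conjI allI impI V)
    fix \<delta> :: real assume \<delta>: "0 \<le> \<delta>"
    define r where "r = nat \<lfloor>\<delta> / V\<rfloor>"
    have r: "real r \<le> \<delta> / V" "\<delta> / V < real r + 1" using \<delta> V by (simp_all add: r_def)
    let ?Y = "{y :: real ^ 'n. int_vec y \<and> (\<forall>j. of_int (- int r) \<le> y $ j \<and> y $ j \<le> of_int (int r))}"
    have "(\<lambda>y. real r *\<^sub>R v + y) ` ?Y \<subseteq> S \<inter> cube \<delta>"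
    proof (intro image_subsetI)
      fix y assume y: "y \<in> ?Y"
      then have yr: "\<bar>y $ j\<bar> \<le> real r" for j by (auto simp: abs_le_iff) (metis minus_le_iff)
      have "real r *\<^sub>R v + y \<in> C"
      \<comment> \<open>Treated separately because the general case divides by
        \<open>r\<close>.\<close>
      proof (cases "r = 0")
        case True
        then have "y = 0" using yr by (simp add: vec_eq_iff)
        then show ?thesis using True cone_0 by simp
      next
        case False
        have "v + (1 / real r) *\<^sub>R y \<in> C" by (rule v(2)) (use yr False in \<open>simp add: abs_mult field_simps\<close>)
        then have "real r *\<^sub>R (v + (1 / real r) *\<^sub>R y) \<in> C" by (rule cone_scaleR) simp
        then show ?thesis using False by (simp add: scaleR_right_distrib)
      qed
      moreover have "int_vec (real r *\<^sub>R v + y)" using y v(1) by (intro int_vec_add int_vec_scaleR) auto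
      moreover have "\<bar>(real r *\<^sub>R v + y) $ j\<bar> \<le> \<delta>" for j
      proof -
        have "\<bar>(real r *\<^sub>R v + y) $ j\<bar> \<le> real r * \<bar>v $ j\<bar> + \<bar>y $ j\<bar>"
          using abs_triangle_ineq[of "real r * v $ j" "y $ j"] by (simp add: abs_mult)
        also have "\<dots> \<le> real r * norm v + real r"
          by (intro add_mono mult_left_mono component_le_norm_cart yr) auto
        also have "\<dots> = real r * V" by (simp add: V_def algebra_simps)
        also have "\<dots> \<le> \<delta>" using r(1) V by (simp add: pos_le_divide_eq)
        finally show ?thesis .
      qed
      ultimately show "real r *\<^sub>R v + y \<in> S \<inter> cube \<delta>"
        unfolding mem_S Int_iff mem_cube by blast
    qed
    then have "card ?Y \<le> card (S \<inter> cube \<delta>)"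
      by (intro card_inj_on_le[of "\<lambda>y. real r *\<^sub>R v + y"] finite_S_cube) (auto simp: inj_on_def)
    moreover have "card ?Y = (2 * r + 1) ^ CARD('n)"
      by (subst card_int_box) (simp add: nat_add_distrib nat_mult_distrib flip: mult_2)
    ultimately have le: "(2 * r + 1) ^ CARD('n) \<le> card (S \<inter> cube \<delta>)" by simp
    have "(\<delta> / V) ^ CARD('n) \<le> real (2 * r + 1) ^ CARD('n)"
      using r \<delta> V by (intro power_mono) auto
    also have "\<dots> = real ((2 * r + 1) ^ CARD('n))" by (rule of_nat_power[symmetric])
    also have "\<dots> \<le> real (card (S \<inter> cube \<delta>))" using le by (simp only: of_nat_le_iff)
    finally show "(\<delta> / V) ^ CARD('n) \<le> real (card (S \<inter> cube \<delta>))" .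
  qed
qed

text \<open>Finitely many slabs contain all long points, so their share of the cube is at most a
  constant divided by \<delta>.\<close>

lemma density_short_rep:
  assumes "dim C = CARD('n)"
  shows "((\<lambda>\<delta>. real (card ({x \<in> S. rep_length C x \<le> CARD('n) + CARD('n) div 2} \<inter> cube \<delta>)) /
            real (card (S \<inter> cube \<delta>))) \<longlongrightarrow> 1) at_top"
proof -
  let ?k = "CARD('n) + CARD('n) div 2"
  let ?good = "\<lambda>\<delta>. {x \<in> S. rep_length C x \<le> ?k} \<inter> cube \<delta>"
  let ?bad = "\<lambda>\<delta>. {x \<in> S. ?k < rep_length C x} \<inter> cube \<delta>"
  obtain V where V: "0 < V" "\<And>\<delta>. 0 \<le> \<delta> \<Longrightarrow> (\<delta> / V) ^ CARD('n) \<le> real (card (S \<inter> cube \<delta>))"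
    using card_S_cube_ge[OF assms] by blast
  obtain F :: "(real ^ 'n) set" and K where F: "finite F" "0 \<notin> F"
    "\<And>x. x \<in> S \<Longrightarrow> ?k < rep_length C x \<Longrightarrow> \<exists>a\<in>F. \<bar>a \<bullet> x\<bar> \<le> K"
    using long_in_slabs by blast
  let ?slab = "\<lambda>\<delta> a. {x. int_vec x \<and> \<bar>a \<bullet> x\<bar> \<le> K} \<inter> cube \<delta>"
  have "\<forall>a\<in>F. \<exists>c. \<forall>\<delta>\<ge>1. real (card (?slab \<delta> a)) \<le> c * \<delta> ^ (CARD('n) - 1)"
  proof
    fix a assume "a \<in> F"
    then have "a \<noteq> 0" using F(2) by blast
    then show "\<exists>c. \<forall>\<delta>\<ge>1. real (card (?slab \<delta> a)) \<le> c * \<delta> ^ (CARD('n) - 1)" by (rule card_slab_le)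
  qed
  from bchoice[OF this] obtain c where c: "\<And>a \<delta>. a \<in> F \<Longrightarrow> 1 \<le> \<delta> \<Longrightarrow> real (card (?slab \<delta> a)) \<le> c a * \<delta> ^ (CARD('n) - 1)"
    by blast
  have ratio: "1 - sum c F * V ^ CARD('n) / \<delta> \<le> real (card (?good \<delta>)) / real (card (S \<inter> cube \<delta>))
      \<and> real (card (?good \<delta>)) / real (card (S \<inter> cube \<delta>)) \<le> 1" if \<delta>: "1 \<le> \<delta>" for \<delta>
  proof -
    define P where "P = (\<delta> / V) ^ CARD('n)"
    have P: "0 < P" "P \<le> real (card (S \<inter> cube \<delta>))" using V \<delta> by (auto simp: P_def)
    have "S \<inter> cube \<delta> = ?good \<delta> \<union> ?bad \<delta>" by auto
    moreover have "card (?good \<delta> \<union> ?bad \<delta>) = card (?good \<delta>) + card (?bad \<delta>)"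
      by (intro card_Un_disjoint finite_subset[OF _ finite_S_cube[of \<delta>]]) auto
    ultimately have total: "real (card (S \<inter> cube \<delta>)) = real (card (?good \<delta>)) + real (card (?bad \<delta>))" by simp
    have "finite (?slab \<delta> a)" for a
      by (rule finite_subset[OF _ finite_int_vec_cube[of \<delta>]]) (auto simp: mem_cube)
    moreover have "?bad \<delta> \<subseteq> (\<Union>a\<in>F. ?slab \<delta> a)" using F(3) mem_S by fastforce
    ultimately have "card (?bad \<delta>) \<le> card (\<Union>a\<in>F. ?slab \<delta> a)" using F(1) by (intro card_mono finite_UN_I)
    also have "\<dots> \<le> (\<Sum>a\<in>F. card (?slab \<delta> a))" by (rule card_UN_le[OF F(1)])
    finally have "real (card (?bad \<delta>)) \<le> (\<Sum>a\<in>F. real (card (?slab \<delta> a)))"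
      by (simp flip: of_nat_sum)
    also have "\<dots> \<le> (\<Sum>a\<in>F. c a * \<delta> ^ (CARD('n) - 1))" by (intro sum_mono c \<delta>)
    also have "\<dots> = sum c F * \<delta> ^ (CARD('n) - 1)" by (simp add: sum_distrib_right)
    finally have bad: "real (card (?bad \<delta>)) \<le> sum c F * \<delta> ^ (CARD('n) - 1)" .
    have "real (card (?bad \<delta>)) / real (card (S \<inter> cube \<delta>)) \<le> real (card (?bad \<delta>)) / P"
      using P by (intro divide_left_mono) auto
    also have "\<dots> \<le> sum c F * \<delta> ^ (CARD('n) - 1) / P" using bad P by (intro divide_right_mono) auto
    also have "\<dots> = sum c F * V ^ CARD('n) / \<delta>"
    proof -
      have "\<delta> ^ CARD('n) = \<delta> * \<delta> ^ (CARD('n) - 1)" by (simp add: power_eq_if)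
      then show ?thesis using \<delta> V(1) by (simp add: P_def power_divide field_simps)
    qed
    finally have "real (card (?bad \<delta>)) / real (card (S \<inter> cube \<delta>)) \<le> sum c F * V ^ CARD('n) / \<delta>" .
    moreover have "real (card (?good \<delta>)) / real (card (S \<inter> cube \<delta>))
        = 1 - real (card (?bad \<delta>)) / real (card (S \<inter> cube \<delta>))"
      using total P by (simp add: field_simps)
    ultimately show ?thesis by simp
  qed
  show ?thesis
  proof (rule tendsto_sandwich)
    have "((\<lambda>\<delta>. sum c F * V ^ CARD('n) / \<delta>) \<longlongrightarrow> 0) at_top"
      by (intro tendsto_divide_0[OF tendsto_const] filterlim_at_top_imp_at_infinity filterlim_ident)
    from tendsto_diff[OF tendsto_const[of 1] this]
    show "((\<lambda>\<delta>. 1 - sum c F * V ^ CARD('n) / \<delta>) \<longlongrightarrow> 1) at_top" by simp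
    show "((\<lambda>_. 1 :: real) \<longlongrightarrow> 1) at_top" by simp
  qed (rule eventually_mono[OF eventually_ge_at_top[of "1 :: real"]]; use ratio in blast)+
qed

end

theorem theorem1:
  fixes C :: "(real ^ 'n) set"
  assumes "rational_cone C"
    and "pointed_cone C"
    and "dim C = CARD('n)"
  shows "int (asymptotic_CR C) \<le> \<lfloor>3 / 2 * real CARD('n)\<rfloor>"
proof -
  obtain m and A :: "nat \<Rightarrow> int ^ 'n" where
    C: "C = {x. \<forall>i<m. (\<Sum>j\<in>UNIV. of_int (A i $ j) * x $ j) \<ge> 0}"
    using assms(1) unfolding rational_cone_def by blast
  interpret pointed_int_cone m "\<lambda>i. \<chi> j. of_int (A i $ j)" C
  proof
    show "C = {x. \<forall>i<m. 0 \<le> (\<chi> j. of_int (A i $ j)) \<bullet> x}" by (simp add: C inner_vec_def)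
    fix x assume "x \<in> C" "- x \<in> C"
    then have "x \<in> C \<inter> uminus ` C" by (metis IntI image_eqI minus_minus)
    then show "x = 0" using assms(2) unfolding pointed_cone_def by blast
  qed (simp add: int_vec_def)
  \<comment> \<open>For a least number it suffices that this positive candidate has the limit
    property.\<close>
  have "asymptotic_CR C \<le> CARD('n) + CARD('n) div 2"
    unfolding asymptotic_CR_def using density_short_rep[OF assms(3)] by (intro Least_le) simp
  also have "real \<dots> \<le> 3 / 2 * real CARD('n)" by linarith
  finally show ?thesis by (simp add: le_floor_iff)
qed

end
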